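(* Let $c\ge 3$ and $h\ge 0$ be fixed natural numbers and $\alpha>0$ real. Let $T_{c,h,\alpha}$ be the perfect $c$-ary tree of height $h$ all of whose edge weights equal $\alpha$. Then $f_3(T_{c,h,\alpha};n)\approx n^{c^h}$.
   Context: A perfect $c$-ary tree of height $h$ is a rooted tree in which every non-leaf vertex has exactly $c$ children and all $c^h$ leaves are at distance $h$ from the root. For an edge-weighted graph $G$ on $m$ vertices with weight function $w$, an $m$-tuple $X$ of points in $\mathbb R^3$ is a distance $G$-configuration if there is a bijection $\varphi:V(G)\to X$ with $|\varphi(u)-\varphi(v)|=w(\{u,v\})$ for all edges. $f_3(G;n)$ is the maximum over all sets of $n$ points in $\mathbb R^3$ of the number of distance $G$-configurations in the set. $X(n)\approx Y(n)$ means $X\le CY$ and $Y\le CX$ for $n>N$, with $C,N$ independent of $n$. *)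

theory Defs
  imports "HOL-Analysis.Analysis"
begin

section \<open>Finite simple graphs and trees\<close>

(* The symmetric digraphs of the AFP entry Graph_Theory are not used: there u, v, u counts as a
   cycle, so that its predicate "tree" fails for every undirected graph with an edge. *)

definition is_graph :: "'v set \<Rightarrow> 'v set set \<Rightarrow> bool" where
  "is_graph V E \<longleftrightarrow> finite V \<and> E \<subseteq> {{u, v} | u v. u \<in> V \<and> v \<in> V \<and> u \<noteq> v}"

definition is_path :: "'v set \<Rightarrow> 'v set set \<Rightarrow> 'v \<Rightarrow> 'v list \<Rightarrow> 'v \<Rightarrow> bool" where
  "is_path V E u p v \<longleftrightarrow>
     p \<noteq> [] \<and> hd p = u \<and> last p = v \<and> set p \<subseteq> V \<and> distinct p \<and>
     successively (\<lambda>x y. {x, y} \<in> E) p"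

definition is_tree :: "'v set \<Rightarrow> 'v set set \<Rightarrow> bool" where
  "is_tree V E \<longleftrightarrow>
     is_graph V E \<and> V \<noteq> {} \<and> (\<forall>u\<in>V. \<forall>v\<in>V. \<exists>!p. is_path V E u p v)"

definition graph_dist :: "'v set \<Rightarrow> 'v set set \<Rightarrow> 'v \<Rightarrow> 'v \<Rightarrow> nat" where
  "graph_dist V E u v = (LEAST k. \<exists>p. is_path V E u p v \<and> length p = Suc k)"

definition children :: "'v set \<Rightarrow> 'v set set \<Rightarrow> 'v \<Rightarrow> 'v \<Rightarrow> 'v set" where
  "children V E r v = {u \<in> V. {v, u} \<in> E \<and> (\<exists>p. is_path V E r p u \<and> v \<in> set p)}"

definition leaves :: "'v set \<Rightarrow> 'v set set \<Rightarrow> 'v \<Rightarrow> 'v set" where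
  "leaves V E r = {v \<in> V. children V E r v = {}}"

definition perfect_tree :: "nat \<Rightarrow> nat \<Rightarrow> 'v set \<Rightarrow> 'v set set \<Rightarrow> 'v \<Rightarrow> bool" where
  "perfect_tree c h V E r \<longleftrightarrow>
     is_tree V E \<and> r \<in> V \<and>
     (\<forall>v \<in> V - leaves V E r. card (children V E r v) = c) \<and>
     card (leaves V E r) = c ^ h \<and>
     (\<forall>v \<in> leaves V E r. graph_dist V E r v = h)"

section \<open>Distance configurations\<close>

(* A tuple is a list; the length condition together with the bijection onto its set of entries
   forces the entries to be distinct.  Tuples are counted as ordered tuples. *)
definition distance_configuration ::
  "'v set \<Rightarrow> 'v set set \<Rightarrow> ('v set \<Rightarrow> real) \<Rightarrow> (real ^ 3) list \<Rightarrow> bool" where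
  "distance_configuration V E w X \<longleftrightarrow>
     length X = card V \<and>
     (\<exists>\<phi>. bij_betw \<phi> V (set X) \<and>
          (\<forall>u\<in>V. \<forall>v\<in>V. {u, v} \<in> E \<longrightarrow> dist (\<phi> u) (\<phi> v) = w {u, v}))"

definition configurations ::
  "'v set \<Rightarrow> 'v set set \<Rightarrow> ('v set \<Rightarrow> real) \<Rightarrow> (real ^ 3) set \<Rightarrow> (real ^ 3) list set" where
  "configurations V E w P = {X. set X \<subseteq> P \<and> distance_configuration V E w X}"

definition f3 :: "'v set \<Rightarrow> 'v set set \<Rightarrow> ('v set \<Rightarrow> real) \<Rightarrow> nat \<Rightarrow> nat" where
  "f3 V E w n = Max {card (configurations V E w P) | P. finite P \<and> card P = n}"

(* The maximum in f3 ranges over a finite nonempty set. *)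
lemma card_configurations_le:
  assumes "finite P" "card P = n"
  shows "finite (configurations V E w P)" "card (configurations V E w P) \<le> n ^ card V"
proof -
  have sub: "configurations V E w P \<subseteq> {X. set X \<subseteq> P \<and> length X = card V}"
    by (auto simp: configurations_def distance_configuration_def)
  show "finite (configurations V E w P)"
    by (rule finite_subset[OF sub finite_lists_length_eq[OF assms(1)]])
  show "card (configurations V E w P) \<le> n ^ card V"
    using card_mono[OF finite_lists_length_eq[OF assms(1)] sub]
      card_lists_length_eq[OF assms(1), of "card V"] assms(2) by simp
qed

lemma f3_max_wf:
  "finite {card (configurations V E w P) | P. finite P \<and> card P = n}"
  "{card (configurations V E w P) | P. finite P \<and> card P = n} \<noteq> {}"
proof -
  have "{card (configurations V E w P) | P. finite P \<and> card P = n} \<subseteq> {..n ^ card V}"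
    by (auto intro!: card_configurations_le(2))
  then show "finite {card (configurations V E w P) | P. finite P \<and> card P = n}"
    by (rule finite_subset) simp
  have "infinite (UNIV :: (real ^ 3) set)"
    by (rule infinite_UNIV_vec[OF infinite_UNIV_char_0])
  then obtain P :: "(real ^ 3) set" where "finite P" "card P = n"
    using infinite_arbitrarily_large by blast
  then show "{card (configurations V E w P) | P. finite P \<and> card P = n} \<noteq> {}"
    by blast
qed

section \<open>Equality of orders of magnitude\<close>

definition same_order :: "(nat \<Rightarrow> real) \<Rightarrow> (nat \<Rightarrow> real) \<Rightarrow> bool" where
  "same_order X Y \<longleftrightarrow> (\<exists>C>0. \<exists>N. \<forall>n>N. X n \<le> C * Y n \<and> Y n \<le> C * X n)"

end

theory Submission
  imports Defs
begin

(* Upper bound: the children of an internal vertex are at least three distinct points at distance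
   \<alpha> from it, which leaves at most two positions for it. So the positions of the leaves determine
   a configuration up to a bounded number of choices.
   Lower bound: fix the positions of the internal vertices and let every leaf range over its own
   set of about n / card V points on the sphere around its parent. *)

section \<open>Points equidistant from three given points\<close>

text \<open>A line meets a sphere in at most two points, and parameter 0 already gives one of them.
  Squaring \<open>norm (w + a *\<^sub>R v) = norm w\<close> and dividing by
  \<open>a \<noteq> 0\<close> leaves a linear equation for \<open>a\<close>, which has one
  root.\<close>

lemma collinear_points_on_sphere:
  fixes w v :: "'a::real_inner"
  assumes "v \<noteq> 0" "s \<noteq> 0" "t \<noteq> 0"
    and "norm (w + s *\<^sub>R v) = norm w" "norm (w + t *\<^sub>R v) = norm w"
  shows "s = t"
proof -
  have "2 * (w \<bullet> v) + a * (v \<bullet> v) = 0" if "a \<noteq> 0" "norm (w + a *\<^sub>R v) = norm w" for a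
  proof -
    have "(w + a *\<^sub>R v) \<bullet> (w + a *\<^sub>R v) = w \<bullet> w"
      using that(2) by (simp add: norm_eq)
    then have "a * (2 * (w \<bullet> v) + a * (v \<bullet> v)) = 0"
      by (simp add: inner_simps inner_commute[of v w] algebra_simps)
    then show ?thesis using that(1) by simp
  qed
  from this[of s] this[of t] have "s * (v \<bullet> v) = t * (v \<bullet> v)"
    using assms by linarith
  then show ?thesis using assms(1) by simp
qed

text \<open>If the cross product vanished, \<open>a\<close>, \<open>b\<close>, \<open>c\<close>
  would be three distinct points of one line on the sphere about \<open>x\<close>.\<close>

lemma cross3_neq_0_on_sphere:
  fixes x a b c :: "real^3"
  assumes "dist x a = \<alpha>" "dist x b = \<alpha>" "dist x c = \<alpha>" "a \<noteq> b" "a \<noteq> c" "b \<noteq> c"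
  shows "cross3 (b - a) (c - a) \<noteq> 0"
proof
  assume "cross3 (b - a) (c - a) = 0"
  then have "collinear {0, b - a, c - a}" by (simp add: cross_eq_0)
  then obtain t where t: "c - a = t *\<^sub>R (b - a)"
    using assms by (auto simp: collinear_lemma)
  \<comment> \<open>Seen from the centre \<open>x\<close>, the line starts at \<open>a - x\<close>
    with direction \<open>b - a\<close>; it reaches \<open>b\<close> at parameter 1 and
    \<open>c\<close> at parameter \<open>t\<close>.\<close>
  have "1 = t"
  proof (rule collinear_points_on_sphere)
    show "norm ((a - x) + 1 *\<^sub>R (b - a)) = norm (a - x)"
      using assms by (simp add: dist_norm norm_minus_commute)
    have "(a - x) + t *\<^sub>R (b - a) = c - x" by (simp flip: t)
    moreover have "norm (c - x) = norm (a - x)"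
      using assms by (simp add: dist_norm norm_minus_commute)
    ultimately show "norm ((a - x) + t *\<^sub>R (b - a)) = norm (a - x)" by metis
  qed (use assms t in auto)
  with t assms show False by auto
qed

text \<open>Equal distances force the differences within one triple to be orthogonal to those within
  the other. Hence \<open>x\<close>, \<open>y\<close>, \<open>z\<close> lie on a line normal to the
  plane of \<open>a\<close>, \<open>b\<close>, \<open>c\<close>, and also on the sphere about
  \<open>a\<close>, which is one point too many.\<close>

lemma no_three_equidistant:
  fixes x y z a b c :: "real^3"
  assumes "\<forall>p\<in>{x, y, z}. \<forall>q\<in>{a, b, c}. dist p q = \<alpha>"
    and "a \<noteq> b" "a \<noteq> c" "b \<noteq> c" "x \<noteq> y" "x \<noteq> z" "y \<noteq> z"
  shows False
proof -
  let ?n = "cross3 (b - a) (c - a)"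
  have n: "?n \<noteq> 0"
    by (rule cross3_neq_0_on_sphere[of x]) (use assms in auto)
  have orth: "(p - x) \<bullet> (q - a) = 0" if "p \<in> {x, y, z}" "q \<in> {a, b, c}" for p q
  proof -
    have sq: "(p' - q') \<bullet> (p' - q') = \<alpha>\<^sup>2" if "p' \<in> {x, y, z}" "q' \<in> {a, b, c}" for p' q'
    proof -
      have "dist p' q' = \<alpha>" using assms(1) that by blast
      then show ?thesis by (simp add: dist_norm flip: power2_norm_eq_inner)
    qed
    \<comment> \<open>Polarization: the inner product is a signed sum of four squared distances
      between the triples, and these cancel.\<close>
    have "2 * ((p - x) \<bullet> (q - a)) = (p - a) \<bullet> (p - a) + (x - q) \<bullet> (x - q)
        - (p - q) \<bullet> (p - q) - (x - a) \<bullet> (x - a)"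
      by (simp add: inner_diff_left inner_diff_right inner_commute)
    then show ?thesis
      using sq[of p q] sq[of p a] sq[of x q] sq[of x a] that by simp
  qed
  have par: "\<exists>s. p - x = s *\<^sub>R ?n" if "p \<in> {x, y, z}" for p
  proof -
    \<comment> \<open>The Lagrange expansion of the triple product is a combination of
      \<open>b - a\<close> and \<open>c - a\<close> whose coefficients are inner products that
      vanish by \<open>orth\<close>.\<close>
    have "cross3 (p - x) ?n = 0"
      using orth[OF that, of b] orth[OF that, of c] by (simp add: Lagrange)
    then have "collinear {0, ?n, p - x}" by (simp add: cross_eq_0 insert_commute)
    then show ?thesis using n by (auto simp: collinear_lemma intro: exI[of _ 0])
  qed
  obtain s t where s: "y - x = s *\<^sub>R ?n" and t: "z - x = t *\<^sub>R ?n"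
    using par[of y] par[of z] by auto
  have eq: "(x - a) + s *\<^sub>R ?n = y - a" "(x - a) + t *\<^sub>R ?n = z - a"
    by (simp_all flip: s t)
  have "s = t"
    by (rule collinear_points_on_sphere[OF n, of s t "x - a"])
      (use assms s t in \<open>auto simp: eq simp flip: dist_norm\<close>)
  with s t have "y - x = z - x" by simp
  with assms show False by simp
qed

lemma ex_three_distinct:
  assumes "3 \<le> card A"
  shows "\<exists>x\<in>A. \<exists>y\<in>A. \<exists>z\<in>A. x \<noteq> y \<and> x \<noteq> z \<and> y \<noteq> z"
proof -
  obtain B where "B \<subseteq> A" "card B = 3" using obtain_subset_with_card_n[OF assms] by metis
  then show ?thesis by (auto simp: card_3_iff)
qed

text \<open>In the upper bound, \<open>B\<close> holds the positions of the children of a vertex and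
  \<open>A\<close> the positions still open to that vertex.\<close>

lemma card_equidistant_le:
  fixes A B :: "(real^3) set"
  assumes "3 \<le> card B" "\<forall>x\<in>A. \<forall>y\<in>B. dist x y = \<alpha>"
  shows "card A \<le> 2"
proof (rule ccontr)
  assume "\<not> card A \<le> 2"
  then obtain x y z where xyz: "x \<in> A" "y \<in> A" "z \<in> A" "x \<noteq> y" "x \<noteq> z" "y \<noteq> z"
    using ex_three_distinct[of A] by (auto simp: not_le)
  obtain a b c where abc: "a \<in> B" "b \<in> B" "c \<in> B" "a \<noteq> b" "a \<noteq> c" "b \<noteq> c"
    using ex_three_distinct[OF assms(1)] by blast
  show False
    by (rule no_three_equidistant[of x y z a b c \<alpha>]) (use assms(2) xyz abc in auto)
qed

text \<open>A finite connected set has at most one point, whereas the sphere is connected and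
  contains the antipodes \<open>a + e\<close> and \<open>a - e\<close>.\<close>

lemma infinite_sphere3:
  fixes a :: "real^3"
  assumes "0 < \<alpha>"
  shows "infinite (sphere a \<alpha>)"
proof
  assume fin: "finite (sphere a \<alpha>)"
  have "connected (sphere a \<alpha>)" by (rule connected_sphere) simp
  then have "sphere a \<alpha> = {} \<or> (\<exists>y. sphere a \<alpha> = {y})"
    using fin connected_finite_iff_sing by blast
  moreover obtain e :: "real^3" where e: "norm e = \<alpha>"
    using vector_choose_size[of \<alpha>] assms by auto
  then have "a + e \<in> sphere a \<alpha>" "a - e \<in> sphere a \<alpha>"
    by (simp_all add: dist_norm)
  moreover have "(a + e) - (a - e) = 2 *\<^sub>R e" by (simp add: scaleR_2)
  with e assms have "a + e \<noteq> a - e" by auto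
  ultimately show False by (metis empty_iff singletonD)
qed

section \<open>Rooted trees\<close>

lemma is_path_snoc:
  assumes "is_path V E r p v" "u \<in> V" "u \<notin> set p" "{v, u} \<in> E"
  shows "is_path V E r (p @ [u]) u"
  using assms by (auto simp: is_path_def successively_append_iff)

lemma is_path_prefix:
  assumes "is_path V E r (xs @ v # ys) u"
  shows "is_path V E r (xs @ [v]) v"
  using assms by (cases xs) (auto simp: is_path_def successively_append_iff successively_Cons hd_append)

locale rooted_tree =
  fixes V :: "'v set" and E :: "'v set set" and r :: 'v
  assumes tree: "is_tree V E" and root: "r \<in> V"
begin

text \<open>The length of this path is the depth of \<open>v\<close> plus one. Both bounds process
  the vertices in the order of this length.\<close>

definition root_path :: "'v \<Rightarrow> 'v list" where
  "root_path v = (THE p. is_path V E r p v)"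

lemma finite_V: "finite V" and V_nonempty: "V \<noteq> {}"
  using tree by (auto simp: is_tree_def is_graph_def)

lemma edge_neq: "{v, u} \<in> E \<Longrightarrow> v \<noteq> u"
  using tree by (auto simp: is_tree_def is_graph_def doubleton_eq_iff)

lemma root_path:
  assumes "v \<in> V"
  shows "is_path V E r (root_path v) v"
proof -
  have "\<exists>!p. is_path V E r p v" using tree root assms by (simp add: is_tree_def)
  then show ?thesis unfolding root_path_def by (rule theI')
qed

lemma root_path_eq:
  assumes "is_path V E r p v"
  shows "root_path v = p"
proof -
  have "v \<in> V" using assms by (auto simp: is_path_def)
  with tree root have "\<exists>!p. is_path V E r p v" by (auto simp: is_tree_def)
  with assms show ?thesis unfolding root_path_def by blast
qed

text \<open>\<open>children\<close> only demands that \<open>v\<close> occur somewhere on the path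
  to \<open>u\<close>. Cutting that path at \<open>v\<close> and stepping along the edge to
  \<open>u\<close> gives another path to \<open>u\<close>, so by uniqueness \<open>v\<close> is the
  last vertex before \<open>u\<close>.\<close>

lemma root_path_child:
  assumes "u \<in> children V E r v"
  shows "root_path u = root_path v @ [u]"
proof -
  from assms obtain p where u: "u \<in> V" "{v, u} \<in> E" and p: "is_path V E r p u" "v \<in> set p"
    by (auto simp: children_def)
  obtain xs ys where xy: "p = xs @ v # ys" using p(2) by (meson split_list)
  have "u \<noteq> v" using u(2) edge_neq by blast
  \<comment> \<open>As the last vertex of a path without repetitions, \<open>u\<close> lies behind
    \<open>v\<close> and so is absent from the prefix.\<close>
  with p(1) xy have "u \<in> set ys" by (auto simp: is_path_def split: if_splits)
  with p(1) xy have "u \<notin> set (xs @ [v])" by (auto simp: is_path_def)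
  moreover have pv: "is_path V E r (xs @ [v]) v" using p(1) xy by (auto intro: is_path_prefix)
  ultimately have "is_path V E r ((xs @ [v]) @ [u]) u"
    using u by (intro is_path_snoc)
  with pv show ?thesis by (simp add: root_path_eq)
qed

lemma length_root_path_child:
  "u \<in> children V E r v \<Longrightarrow> length (root_path v) < length (root_path u)"
  by (simp add: root_path_child)

lemma parent_unique:
  assumes "u \<in> children V E r v" "u \<in> children V E r v'" "v \<in> V" "v' \<in> V"
  shows "v = v'"
proof -
  have "root_path v = root_path v'"
    using assms(1,2)[THEN root_path_child] by simp
  then show ?thesis
    using root_path[OF assms(3)] root_path[OF assms(4)] by (auto simp: is_path_def)
qed

text \<open>If the root path of \<open>u\<close> passes through \<open>v\<close>, then
  \<open>u\<close> is a child of \<open>v\<close>. Otherwise this path extends by \<open>v\<close>,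
  and the extension shows that \<open>v\<close> is a child of \<open>u\<close>.\<close>

lemma edge_cases:
  assumes "{u, v} \<in> E" "u \<in> V" "v \<in> V"
  shows "u \<in> children V E r v \<or> v \<in> children V E r u"
proof (cases "v \<in> set (root_path u)")
  case True
  then show ?thesis
    using assms root_path[OF assms(2)] by (auto simp: children_def insert_commute)
next
  case False
  then have "is_path V E r (root_path u @ [v]) v"
    using assms root_path[OF assms(2)] by (intro is_path_snoc) auto
  moreover have "u \<in> set (root_path u)"
    using root_path[OF assms(2)] unfolding is_path_def by (metis last_in_set)
  ultimately show ?thesis
    using assms by (auto simp: children_def intro!: exI[of _ "root_path u @ [v]"])
qed

lemma edge_distances:
  assumes "\<And>u v. v \<in> V \<Longrightarrow> u \<in> children V E r v \<Longrightarrow> dist (\<phi> u) (\<phi> v) = \<alpha>"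
    and "u \<in> V" "v \<in> V" "{u, v} \<in> E"
  shows "dist (\<phi> u) (\<phi> v) = \<alpha>"
  using edge_cases[OF assms(4,2,3)] assms(1)[of v u] assms(1)[of u v] assms(2,3)
  by (metis dist_commute)

section \<open>The upper bound\<close>

text \<open>Functions are extensional on \<open>V\<close>, so that they form a finite set for finite
  \<open>P\<close> and coincide with their restrictions to \<open>V\<close>.\<close>

definition embeddings :: "real \<Rightarrow> (real^3) set \<Rightarrow> ('v \<Rightarrow> real^3) set" where
  "embeddings \<alpha> P = {\<phi> \<in> V \<rightarrow>\<^sub>E P. inj_on \<phi> V \<and>
     (\<forall>u\<in>V. \<forall>v\<in>V. {u, v} \<in> E \<longrightarrow> dist (\<phi> u) (\<phi> v) = \<alpha>)}"

lemma finite_embeddings: "finite P \<Longrightarrow> finite (embeddings \<alpha> P)"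
  by (rule finite_subset[of _ "V \<rightarrow>\<^sub>E P"]) (auto simp: embeddings_def finite_V finite_PiE)

text \<open>An embedding restricted to \<open>S\<close> already places all children of
  \<open>x\<close>, at three or more distinct points at distance \<alpha> from the image of
  \<open>x\<close>. That image therefore has at most two possibilities.\<close>

lemma card_restrict_insert_le:
  assumes P: "finite P" and x: "x \<in> V" "x \<notin> S" "3 \<le> card (children V E r x)"
    and S: "children V E r x \<subseteq> S"
  shows "card ((\<lambda>\<phi>. restrict \<phi> (insert x S)) ` embeddings \<alpha> P)
    \<le> 2 * card ((\<lambda>\<phi>. restrict \<phi> S) ` embeddings \<alpha> P)"
proof -
  let ?R = "\<lambda>S. (\<lambda>\<phi>. restrict \<phi> S) ` embeddings \<alpha> P"
  \<comment> \<open>All positions of \<open>x\<close> in embeddings that agree with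
    \<open>\<psi>\<close> on \<open>S\<close>.\<close>
  let ?F = "\<lambda>\<psi>. {\<phi> x |\<phi>. \<phi> \<in> embeddings \<alpha> P \<and> restrict \<phi> S = \<psi>}"
  have fin: "finite (?R S)" using P finite_embeddings by blast
  have finF: "finite (?F \<psi>)" for \<psi>
    by (rule finite_subset[of _ P]) (use P x in \<open>auto simp: embeddings_def\<close>)
  have F: "card (?F \<psi>) \<le> 2" if "\<psi> \<in> ?R S" for \<psi>
  proof (rule card_equidistant_le)
    let ?B = "\<psi> ` children V E r x"
    have ch: "children V E r x \<subseteq> V" by (auto simp: children_def)
    have "inj_on \<psi> (children V E r x)"
      using that S ch by (auto simp: embeddings_def inj_on_def subset_iff)
    then show "3 \<le> card ?B" using x by (simp add: card_image)
    show "\<forall>a\<in>?F \<psi>. \<forall>b\<in>?B. dist a b = \<alpha>"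
    proof (intro ballI)
      fix a b assume "a \<in> ?F \<psi>" "b \<in> ?B"
      then obtain \<phi> u where \<phi>: "\<phi> \<in> embeddings \<alpha> P" "restrict \<phi> S = \<psi>" "a = \<phi> x"
        and u: "u \<in> children V E r x" "b = \<psi> u" by blast
      have "b = \<phi> u" using u \<phi>(2) S by auto
      moreover have "{x, u} \<in> E" "u \<in> V" using u by (auto simp: children_def)
      ultimately show "dist a b = \<alpha>" using \<phi> x by (auto simp: embeddings_def)
    qed
  qed
  \<comment> \<open>A restriction to \<open>insert x S\<close> is recovered from the one to
    \<open>S\<close> and the image of \<open>x\<close>.\<close>
  have "?R (insert x S) \<subseteq> (\<lambda>(\<psi>, a). \<psi>(x := a)) ` (SIGMA \<psi>:?R S. ?F \<psi>)"
  proof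
    fix g assume "g \<in> ?R (insert x S)"
    then obtain \<phi> where \<phi>: "\<phi> \<in> embeddings \<alpha> P" "g = restrict \<phi> (insert x S)" by blast
    then have "g = (\<lambda>(\<psi>, a). \<psi>(x := a)) (restrict \<phi> S, \<phi> x)" by (auto simp: fun_eq_iff)
    moreover have "(restrict \<phi> S, \<phi> x) \<in> (SIGMA \<psi>:?R S. ?F \<psi>)" using \<phi> by auto
    ultimately show "g \<in> (\<lambda>(\<psi>, a). \<psi>(x := a)) ` (SIGMA \<psi>:?R S. ?F \<psi>)" by (rule image_eqI)
  qed
  then have "card (?R (insert x S)) \<le> card (SIGMA \<psi>:?R S. ?F \<psi>)"
    by (rule surj_card_le[OF finite_SigmaI[OF fin finF]])
  also have "\<dots> = (\<Sum>\<psi>\<in>?R S. card (?F \<psi>))"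
    using fin finF by (simp add: card_SigmaI)
  also have "\<dots> \<le> card (?R S) * 2"
    using sum_bounded_above[of "?R S" "\<lambda>\<psi>. card (?F \<psi>)" 2] F by simp
  finally show ?thesis by (simp add: mult.commute)
qed

text \<open>Internal vertices are removed from the domain in order of increasing depth. The children
  of the vertex being removed are deeper, hence still in the domain, so each removal costs a factor
  of at most 2. In the end only the leaves remain.\<close>

lemma card_embeddings_le:
  assumes P: "finite P"
    and br: "\<forall>v\<in>V - leaves V E r. 3 \<le> card (children V E r v)"
  shows "card (embeddings \<alpha> P) \<le> 2 ^ card V * card P ^ card (leaves V E r)"
proof -
  let ?R = "\<lambda>S. (\<lambda>\<phi>. restrict \<phi> S) ` embeddings \<alpha> P"
  let ?L = "leaves V E r"
  have L: "?L \<subseteq> V" by (auto simp: leaves_def)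
  then have finL: "finite ?L" using finite_V finite_subset by blast
  have "restrict \<phi> V = \<phi>" if "\<phi> \<in> embeddings \<alpha> P" for \<phi>
    using that PiE_restrict[of \<phi> V "\<lambda>_. P"] by (simp add: embeddings_def)
  then have RV: "?R (V - {}) = embeddings \<alpha> P" by simp
  have "T \<subseteq> V - ?L \<longrightarrow> card (embeddings \<alpha> P) \<le> 2 ^ card T * card (?R (V - T))"
    if "finite T" for T
    using that
  proof (induction T rule: finite_ranking_induct[where f = "\<lambda>v. length (root_path v)"])
    case empty
    then show ?case by (simp only: RV) simp
  next
    case (insert x T)
    show ?case
    proof (intro impI)
      assume sub: "insert x T \<subseteq> V - ?L"
      show "card (embeddings \<alpha> P) \<le> 2 ^ card (insert x T) * card (?R (V - insert x T))"
      \<comment> \<open>The ranking induction adds a vertex of maximal depth, but does not say that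
        it is new.\<close>
      proof (cases "x \<in> T")
        case True
        then have eq: "insert x T = T" by blast
        show ?thesis unfolding eq using insert.IH sub by blast
      next
        case False
        have ch: "children V E r x \<subseteq> V - insert x T"
          using insert.hyps length_root_path_child[of _ x] by (fastforce simp: children_def)
        have "card (embeddings \<alpha> P) \<le> 2 ^ card T * card (?R (V - T))"
          using insert.IH sub by blast
        also have "V - T = insert x (V - insert x T)" using sub False by auto
        also have "card (?R (insert x (V - insert x T))) \<le> 2 * card (?R (V - insert x T))"
          by (rule card_restrict_insert_le[OF P]) (use br sub ch in auto)
        finally show ?thesis using False insert.hyps by (simp add: mult_ac)
      qed
    qed
  qed
  from this[of "V - ?L"] have "card (embeddings \<alpha> P) \<le> 2 ^ card (V - ?L) * card (?R ?L)"
    using finite_V L by (simp add: double_diff)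
  also have "\<dots> \<le> 2 ^ card V * card P ^ card ?L"
  proof (rule mult_mono)
    show "(2::nat) ^ card (V - ?L) \<le> 2 ^ card V"
      by (intro power_increasing card_mono) (auto simp: finite_V)
    have "card (?R ?L) \<le> card (?L \<rightarrow>\<^sub>E P)"
      by (rule card_mono) (use finL P L in \<open>auto simp: embeddings_def intro: finite_PiE\<close>)
    then show "card (?R ?L) \<le> card P ^ card ?L" using finL by (simp add: card_PiE)
  qed auto
  finally show ?thesis .
qed

text \<open>A configuration is an embedding applied to some list of the vertices. Counting all lists
  of length \<open>card V\<close> over \<open>V\<close> bounds the possible orders by
  \<open>card V ^ card V\<close>.\<close>

lemma card_configurations_le_leaves:
  assumes P: "finite P"
    and br: "\<forall>v\<in>V - leaves V E r. 3 \<le> card (children V E r v)"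
  shows "card (configurations V E (\<lambda>_. \<alpha>) P)
    \<le> 2 ^ card V * card V ^ card V * card P ^ card (leaves V E r)"
proof -
  let ?W = "{ws. set ws \<subseteq> V \<and> length ws = card V}"
  have fin: "finite (embeddings \<alpha> P \<times> ?W)"
    using finite_embeddings[OF P] finite_lists_length_eq[OF finite_V] by blast
  have "configurations V E (\<lambda>_. \<alpha>) P \<subseteq> (\<lambda>(\<phi>, ws). map \<phi> ws) ` (embeddings \<alpha> P \<times> ?W)"
  proof
    fix X assume "X \<in> configurations V E (\<lambda>_. \<alpha>) P"
    then obtain \<phi> where X: "set X \<subseteq> P" "length X = card V" and \<phi>: "bij_betw \<phi> V (set X)"
      "\<forall>u\<in>V. \<forall>v\<in>V. {u, v} \<in> E \<longrightarrow> dist (\<phi> u) (\<phi> v) = \<alpha>"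
      by (auto simp: configurations_def distance_configuration_def)
    \<comment> \<open>\<open>?ws\<close> lists the vertices in the order in which their images occur
      in \<open>X\<close>.\<close>
    let ?\<phi> = "restrict \<phi> V" and ?ws = "map (inv_into V \<phi>) X"
    have img: "\<phi> ` V = set X" using \<phi>(1) by (simp add: bij_betw_def)
    have "?\<phi> \<in> embeddings \<alpha> P"
      using \<phi> X img by (auto simp: embeddings_def bij_betw_def inj_on_def)
    moreover have "?ws \<in> ?W" using X img by (auto intro: inv_into_into)
    moreover have "map ?\<phi> ?ws = X"
      by (auto simp: img map_idI inv_into_into f_inv_into_f intro!: map_idI)
    ultimately show "X \<in> (\<lambda>(\<phi>, ws). map \<phi> ws) ` (embeddings \<alpha> P \<times> ?W)"
      by (intro image_eqI[of _ _ "(?\<phi>, ?ws)"]) auto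
  qed
  then have "card (configurations V E (\<lambda>_. \<alpha>) P) \<le> card (embeddings \<alpha> P \<times> ?W)"
    by (rule surj_card_le[OF fin])
  also have "\<dots> = card (embeddings \<alpha> P) * card V ^ card V"
    by (simp add: card_cartesian_product card_lists_length_eq[OF finite_V])
  also have "\<dots> \<le> (2 ^ card V * card P ^ card (leaves V E r)) * card V ^ card V"
    using card_embeddings_le[OF P br] by (intro mult_right_mono) auto
  finally show ?thesis by (simp add: mult_ac)
qed

section \<open>The lower bound\<close>

text \<open>Vertices are added by increasing depth, so a parent precedes its children. A parent has
  a single position, and the sphere about it is infinite, which leaves room for fresh points away
  from the finitely many already used.\<close>

lemma ex_position_sets:
  assumes "0 < \<alpha>" and "finite S" "S \<subseteq> V"
  shows "\<exists>A :: 'v \<Rightarrow> (real^3) set.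
    (\<forall>v\<in>S. finite (A v) \<and> card (A v) = (if v \<in> leaves V E r then k else 1)) \<and>
    (\<forall>u\<in>S. \<forall>v\<in>S. u \<noteq> v \<longrightarrow> A u \<inter> A v = {}) \<and>
    (\<forall>v\<in>S. \<forall>u\<in>S. u \<in> children V E r v \<longrightarrow> (\<forall>x\<in>A v. \<forall>y\<in>A u. dist y x = \<alpha>))"
  using assms(2,3)
proof (induction S rule: finite_ranking_induct[where f = "\<lambda>v. length (root_path v)"])
  case empty
  then show ?case by simp
next
  case (insert w S)
  show ?case
  proof (cases "w \<in> S")
    case True
    then show ?thesis using insert.IH insert.prems by (simp add: insert_absorb)
  next
    case False
    obtain A :: "'v \<Rightarrow> (real^3) set" where
      A1: "\<forall>v\<in>S. finite (A v) \<and> card (A v) = (if v \<in> leaves V E r then k else 1)" and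
      A2: "\<forall>u\<in>S. \<forall>v\<in>S. u \<noteq> v \<longrightarrow> A u \<inter> A v = {}" and
      A3: "\<forall>v\<in>S. \<forall>u\<in>S. u \<in> children V E r v \<longrightarrow> (\<forall>x\<in>A v. \<forall>y\<in>A u. dist y x = \<alpha>)"
      using insert.IH insert.prems by auto
    let ?k = "if w \<in> leaves V E r then k else 1"
    \<comment> \<open>\<open>D\<close> is the region allowed for \<open>w\<close>: the sphere about
      its parent if that is already placed, otherwise all of space.\<close>
    have "\<exists>D. infinite D \<and> (\<forall>v\<in>S. w \<in> children V E r v \<longrightarrow> (\<forall>x\<in>A v. \<forall>y\<in>D. dist y x = \<alpha>))"
    proof (cases "\<exists>v\<in>S. w \<in> children V E r v")
      case True
      then obtain v where v: "v \<in> S" "w \<in> children V E r v" by blast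
      then have "v \<notin> leaves V E r" by (auto simp: leaves_def)
      then obtain a where a: "A v = {a}" using A1 v by (metis card_1_singletonE)
      have "v' = v" if "v' \<in> S" "w \<in> children V E r v'" for v'
        using parent_unique[OF that(2) v(2)] that(1) v(1) insert.prems by blast
      then have "\<forall>v'\<in>S. w \<in> children V E r v' \<longrightarrow> (\<forall>x\<in>A v'. \<forall>y\<in>sphere a \<alpha>. dist y x = \<alpha>)"
        using a by (auto simp: dist_commute)
      with infinite_sphere3[OF assms(1), of a] show ?thesis by blast
    next
      case False
      have "infinite (UNIV :: (real^3) set)"
        by (rule infinite_UNIV_vec[OF infinite_UNIV_char_0])
      with False show ?thesis by blast
    qed
    then obtain D :: "(real^3) set" where D: "infinite D"
      "\<forall>v\<in>S. w \<in> children V E r v \<longrightarrow> (\<forall>x\<in>A v. \<forall>y\<in>D. dist y x = \<alpha>)" by blast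
    have "finite (\<Union>v\<in>S. A v)" using A1 insert.hyps by auto
    then have "infinite (D - (\<Union>v\<in>S. A v))" using D(1) by simp
    then obtain B where B: "finite B" "card B = ?k" "B \<subseteq> D - (\<Union>v\<in>S. A v)"
      using infinite_arbitrarily_large by blast
    \<comment> \<open>No vertex present is deeper than \<open>w\<close>, so \<open>w\<close> enters
      the distance condition only as a child.\<close>
    have no_child: "u \<notin> children V E r w" if "u \<in> insert w S" for u
      using that insert.hyps length_root_path_child[of u w] by fastforce
    show ?thesis
    proof (intro exI[of _ "A(w := B)"] conjI)
      show "\<forall>v\<in>insert w S. finite ((A(w := B)) v) \<and>
          card ((A(w := B)) v) = (if v \<in> leaves V E r then k else 1)"
        using A1 B by auto
      show "\<forall>u\<in>insert w S. \<forall>v\<in>insert w S. u \<noteq> v \<longrightarrow> (A(w := B)) u \<inter> (A(w := B)) v = {}"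
        using A2 B(3) by auto
      show "\<forall>v\<in>insert w S. \<forall>u\<in>insert w S. u \<in> children V E r v \<longrightarrow>
          (\<forall>x\<in>(A(w := B)) v. \<forall>y\<in>(A(w := B)) u. dist y x = \<alpha>)"
      proof (intro ballI impI)
        fix v u x y
        assume *: "v \<in> insert w S" "u \<in> insert w S" "u \<in> children V E r v"
          "x \<in> (A(w := B)) v" "y \<in> (A(w := B)) u"
        have "v \<noteq> w" using * no_child by blast
        then have v: "v \<in> S" "x \<in> A v" using * by auto
        show "dist y x = \<alpha>"
        proof (cases "u = w")
          case True
          then show ?thesis using * v D(2) B(3) by auto
        next
          case False
          then show ?thesis using * v A3 by auto
        qed
      qed
    qed
  qed
qed

text \<open>Every choice of one point from each \<open>A v\<close> is a configuration: disjointness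
  of the sets makes it injective, and every edge joins a parent and a child. Only the leaves
  contribute a factor \<open>k\<close>.\<close>

lemma ex_many_configurations:
  assumes "0 < \<alpha>" "1 \<le> k" "card V * k \<le> n"
  shows "\<exists>P. finite P \<and> card P = n \<and>
    k ^ card (leaves V E r) \<le> card (configurations V E (\<lambda>_. \<alpha>) P)"
proof -
  let ?L = "leaves V E r"
  have L: "?L \<subseteq> V" by (auto simp: leaves_def)
  obtain A :: "'v \<Rightarrow> (real^3) set" where
    A1: "\<forall>v\<in>V. finite (A v) \<and> card (A v) = (if v \<in> ?L then k else 1)" and
    A2: "\<forall>u\<in>V. \<forall>v\<in>V. u \<noteq> v \<longrightarrow> A u \<inter> A v = {}" and
    A3: "\<forall>v\<in>V. \<forall>u\<in>V. u \<in> children V E r v \<longrightarrow> (\<forall>x\<in>A v. \<forall>y\<in>A u. dist y x = \<alpha>)"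
    using ex_position_sets[OF assms(1) finite_V subset_refl, of k] by blast
  let ?U = "\<Union>v\<in>V. A v"
  have finU: "finite ?U" using A1 finite_V by auto
  have "card ?U \<le> (\<Sum>v\<in>V. card (A v))" by (rule card_UN_le[OF finite_V])
  also have "\<dots> \<le> card V * k"
    using sum_bounded_above[of V "\<lambda>v. card (A v)" k] A1 assms(2) by simp
  finally have cU: "card ?U \<le> n" using assms(3) by simp
  have "infinite (UNIV - ?U)"
    using finU infinite_UNIV_vec[OF infinite_UNIV_char_0] by (intro Diff_infinite_finite)
  \<comment> \<open>\<open>Q\<close> pads the point set to exactly \<open>n\<close> points.\<close>
  then obtain Q where Q: "finite Q" "card Q = n - card ?U" "Q \<subseteq> UNIV - ?U"
    using infinite_arbitrarily_large by blast
  define P where "P = ?U \<union> Q"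
  have P: "finite P" "card P = n"
    using finU Q cU card_Un_disjoint[OF finU Q(1)] by (auto simp: P_def)
  \<comment> \<open>One fixed order of the vertices turns distinct choice functions into distinct
    tuples.\<close>
  obtain vs where vs: "set vs = V" "length vs = card V"
    using finite_distinct_list[OF finite_V] distinct_card by metis
  have conf: "map g vs \<in> configurations V E (\<lambda>_. \<alpha>) P" if g: "g \<in> Pi\<^sub>E V A" for g
  proof -
    have gA: "g v \<in> A v" if "v \<in> V" for v using g that by auto
    have child: "dist (g u) (g v) = \<alpha>" if "v \<in> V" "u \<in> children V E r v" for u v
    proof -
      have "u \<in> V" using that by (simp add: children_def)
      with that show ?thesis using A3 gA by blast
    qed
    have "inj_on g V"
    proof (rule inj_onI, rule ccontr)
      fix u v assume "u \<in> V" "v \<in> V" "g u = g v" "u \<noteq> v"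
      then show False using A2 gA[of u] gA[of v] by auto
    qed
    then have "bij_betw g V (set (map g vs))" by (simp add: vs bij_betw_def)
    moreover have "\<forall>u\<in>V. \<forall>v\<in>V. {u, v} \<in> E \<longrightarrow> dist (g u) (g v) = \<alpha>"
      by (intro ballI impI) (rule edge_distances[OF child])
    moreover have "set (map g vs) \<subseteq> P" using gA by (auto simp: vs P_def)
    ultimately show ?thesis
      using vs by (auto simp: configurations_def distance_configuration_def)
  qed
  have "inj_on (\<lambda>g. map g vs) (Pi\<^sub>E V A)"
    by (rule inj_onI) (auto simp: vs intro: PiE_ext)
  then have "card (Pi\<^sub>E V A) \<le> card (configurations V E (\<lambda>_. \<alpha>) P)"
    using conf by (intro card_inj_on_le card_configurations_le(1)[OF P]) auto
  moreover have "card (Pi\<^sub>E V A) = (\<Prod>v\<in>V. if v \<in> ?L then k else 1)"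
    using A1 by (simp add: card_PiE finite_V)
  moreover have "\<dots> = k ^ card ?L"
    using L finite_V by (simp add: prod.If_cases Int_absorb1)
  ultimately show ?thesis using P by auto
qed

section \<open>Combining the two bounds\<close>

lemma same_order_f3_leaves:
  assumes "0 < \<alpha>"
    and br: "\<forall>v\<in>V - leaves V E r. 3 \<le> card (children V E r v)"
  shows "same_order (\<lambda>n. real (f3 V E (\<lambda>_. \<alpha>) n)) (\<lambda>n. real n ^ card (leaves V E r))"
proof -
  let ?m = "card V" and ?l = "card (leaves V E r)"
  \<comment> \<open>The first entry is the constant of the upper bound; the second comes from
    raising \<open>n \<le> 2 * card V * k\<close> to the number of leaves.\<close>
  define C where "C = max (2 ^ ?m * ?m ^ ?m) ((2 * ?m) ^ ?l)"
  have m: "0 < ?m" using finite_V V_nonempty by (simp add: card_gt_0_iff)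
  have upper: "f3 V E (\<lambda>_. \<alpha>) n \<le> C * n ^ ?l" for n
  proof -
    have "f3 V E (\<lambda>_. \<alpha>) n \<le> 2 ^ ?m * ?m ^ ?m * n ^ ?l"
      unfolding f3_def
      using card_configurations_le_leaves[OF _ br, of _ \<alpha>] by (subst Max_le_iff[OF f3_max_wf]) auto
    also have "\<dots> \<le> C * n ^ ?l" by (intro mult_right_mono) (auto simp: C_def)
    finally show ?thesis .
  qed
  have lower: "n ^ ?l \<le> C * f3 V E (\<lambda>_. \<alpha>) n" if "?m < n" for n
  proof -
    define k where "k = n div ?m"
    have k: "1 \<le> k" "?m * k \<le> n"
      using that m by (auto simp: k_def div_greater_zero_iff Suc_le_eq)
    obtain P :: "(real^3) set" where P: "finite P" "card P = n"
      "k ^ ?l \<le> card (configurations V E (\<lambda>_. \<alpha>) P)"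
      using ex_many_configurations[OF assms(1) k] by blast
    have "card (configurations V E (\<lambda>_. \<alpha>) P) \<le> f3 V E (\<lambda>_. \<alpha>) n"
      unfolding f3_def using P by (intro Max_ge f3_max_wf) auto
    with P have kf: "k ^ ?l \<le> f3 V E (\<lambda>_. \<alpha>) n" by simp
    \<comment> \<open>The remainder is below \<open>?m\<close>, hence below \<open>?m * k\<close>
      since \<open>k \<ge> 1\<close>; rounding down thus loses at most a factor 2.\<close>
    have "n = ?m * k + n mod ?m" by (simp add: k_def)
    moreover have "n mod ?m < ?m" using m by simp
    moreover have "?m * 1 \<le> ?m * k" using k(1) by (rule mult_left_mono) simp
    ultimately have "n \<le> 2 * ?m * k" by linarith
    then have "n ^ ?l \<le> (2 * ?m * k) ^ ?l" by (rule power_mono) simp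
    also have "\<dots> = (2 * ?m) ^ ?l * k ^ ?l" by (simp add: power_mult_distrib)
    also have "\<dots> \<le> C * f3 V E (\<lambda>_. \<alpha>) n"
      using kf by (intro mult_mono) (auto simp: C_def)
    finally show ?thesis .
  qed
  have "0 < C" using m by (simp add: C_def less_max_iff_disj)
  show ?thesis
    unfolding same_order_def
  proof (intro exI[of _ "real C"] conjI exI[of _ ?m] allI impI)
    fix n assume "?m < n"
    show "real (f3 V E (\<lambda>_. \<alpha>) n) \<le> real C * real n ^ ?l"
      using upper[of n] by (metis of_nat_le_iff of_nat_mult of_nat_power)
    show "real n ^ ?l \<le> real C * real (f3 V E (\<lambda>_. \<alpha>) n)"
      using lower[OF \<open>?m < n\<close>] by (metis of_nat_le_iff of_nat_mult of_nat_power)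
  qed (use \<open>0 < C\<close> in simp)
qed

end

theorem mainTheorem9:
  fixes c h :: nat and \<alpha> :: real and V :: "'v set" and E :: "'v set set" and r :: 'v
  assumes "c \<ge> 3" and "\<alpha> > 0"
    and "perfect_tree c h V E r"
  shows "same_order (\<lambda>n. real (f3 V E (\<lambda>_. \<alpha>) n)) (\<lambda>n. real n ^ (c ^ h))"
proof -
  interpret rooted_tree V E r
    using assms(3) by unfold_locales (auto simp: perfect_tree_def)
  have "\<forall>v\<in>V - leaves V E r. 3 \<le> card (children V E r v)" "card (leaves V E r) = c ^ h"
    using assms by (auto simp: perfect_tree_def)
  with same_order_f3_leaves[OF assms(2)] show ?thesis by simp
qed

end
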